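(* For any non-trivial connected graph $G$ and any integer $t\ge 2D(G)+1$, $$\dim_l(P_t\boxtimes G)\ge \left\lceil\frac{t-1}{D(G)}\right\rceil+1.$$
   Context: $P_t$ is the path on $t$ vertices and $D(G)$ is the diameter of $G$. A set $S$ is a local metric generator for a connected graph $X$ if for every two adjacent vertices $x,y$ there is $s\in S$ with $d_X(s,x)\ne d_X(s,y)$; $\dim_l(X)$ is the minimum cardinality of a local metric generator. The strong product $P_t\boxtimes G$ has vertex set $V(P_t)\times V(G)$, with $(a,b)\sim(c,d)$ iff ($a=c$ and $b\sim d$) or ($b=d$ and $a\sim c$) or ($a\sim c$ and $b\sim d$). *)

theory Defs
  imports Complex_Main "Graph_Theory.Graph_Theory"
begin

text \<open>
  Finite simple graphs are instances of the locale \<^locale>\<open>pair_graph\<close>: an edge is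
  represented by its two opposite arcs, and loops are excluded.
\<close>

text \<open>Meaningful if \<^term>\<open>v\<close> is reachable from \<^term>\<open>u\<close>; see \<open>graph_dist_eq_mu\<close> below.\<close>

definition graph_dist :: "'a pair_pre_digraph \<Rightarrow> 'a \<Rightarrow> 'a \<Rightarrow> nat" where
  "graph_dist X u v = (LEAST n. \<exists>p. pre_digraph.awalk (with_proj X) u p v \<and> length p = n)"

lemma graph_dist_eq_mu:
  assumes wf: "wf_digraph (with_proj X)"
    and ex: "\<exists>p. pre_digraph.awalk (with_proj X) u p v"
  shows "wf_digraph.\<mu> (with_proj X) (\<lambda>_. 1) u v = ereal (real (graph_dist X u v))"
proof -
  interpret wf_digraph "with_proj X" by (fact wf)
  have cost: "awalk_cost (\<lambda>_. 1) p = real (length p)" for p :: "('a \<times> 'a) list"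
    by (induct p) auto
  have "\<exists>n p. awalk u p v \<and> length p = n"
    using ex by blast
  then have "\<exists>p. awalk u p v \<and> length p = graph_dist X u v"
    unfolding graph_dist_def by (rule LeastI_ex)
  then obtain p where p: "awalk u p v" "length p = graph_dist X u v"
    by blast
  have le: "graph_dist X u v \<le> length q" if "awalk u q v" for q
    unfolding graph_dist_def using that by (intro Least_le) auto
  show ?thesis
    unfolding \<mu>_def cost
    by (rule antisym) (use p le in \<open>auto intro!: INF_lower2[of p] INF_greatest\<close>)
qed

definition diam :: "'a pair_pre_digraph \<Rightarrow> nat" where
  "diam X = Max {graph_dist X u v | u v. u \<in> pverts X \<and> v \<in> pverts X}"

definition local_metric_generator :: "'a pair_pre_digraph \<Rightarrow> 'a set \<Rightarrow> bool" where
  "local_metric_generator X S \<longleftrightarrow> S \<subseteq> pverts X \<and>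
     (\<forall>x y. (x, y) \<in> parcs X \<longrightarrow> (\<exists>s\<in>S. graph_dist X s x \<noteq> graph_dist X s y))"

text \<open>
  The minimum is over a nonempty set for a finite simple graph,
  because the full vertex set is a local metric generator.
\<close>

definition local_metric_dim :: "'a pair_pre_digraph \<Rightarrow> nat" where
  "local_metric_dim X = (LEAST k. \<exists>S. local_metric_generator X S \<and> card S = k)"

definition path_graph :: "nat \<Rightarrow> nat pair_pre_digraph" where
  "path_graph t = \<lparr> pverts = {1..t},
     parcs = {(i, j). i \<in> {1..t} \<and> j \<in> {1..t} \<and> (j = i + 1 \<or> i = j + 1)} \<rparr>"

definition strong_product ::
  "'a pair_pre_digraph \<Rightarrow> 'b pair_pre_digraph \<Rightarrow> ('a \<times> 'b) pair_pre_digraph" (infixl "\<boxtimes>" 70) where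
  "H \<boxtimes> G = \<lparr> pverts = pverts H \<times> pverts G,
     parcs = {((a, b), (c, d)).
       a \<in> pverts H \<and> b \<in> pverts G \<and> c \<in> pverts H \<and> d \<in> pverts G \<and>
       (a = c \<and> (b, d) \<in> parcs G \<or>
        b = d \<and> (a, c) \<in> parcs H \<or>
        (a, c) \<in> parcs H \<and> (b, d) \<in> parcs G)} \<rparr>"

end

theory Submission
  imports Defs
begin

text \<open>
  Let \<open>D\<close> be the diameter of \<open>G\<close>.  A landmark \<open>(a, b)\<close> can distinguish an edge inside column \<open>i\<close>
  only if the edge has an endpoint at distance more than \<open>\<bar>a - i\<bar>\<close> from \<open>b\<close>.  Testing edges at
  \<open>b\<close> and on a geodesic between two landmarks shows that a column without landmarks is within
  distance less than \<open>D\<close> of three landmarks, or has two landmarks at offsets with sum at most \<open>D\<close>.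
  Sort the columns of the landmarks.  Consecutive ones may be more than \<open>D\<close> apart, but then this
  gap and its two neighbouring gaps have total length less than \<open>2 * D\<close>; so the gaps, including
  the margins at both ends, have average length at most \<open>D\<close>, that is \<open>t - 1 \<le> D * (k - 1)\<close> for
  \<open>k\<close> landmarks.
\<close>

section \<open>Walks as relation powers, and distances in the strong product\<close>

lemma awalk_iff_relpow:
  assumes "u \<in> pverts X" and "parcs X \<subseteq> pverts X \<times> pverts X"
  shows "(\<exists>p. pre_digraph.awalk (with_proj X) u p v \<and> length p = n) \<longleftrightarrow> (u, v) \<in> parcs X ^^ n"
  using assms(1)
proof (induction n arbitrary: u)
  case 0
  then show ?case
    by (auto simp: pre_digraph.awalk_def pre_digraph.cas.simps)
next
  case (Suc n)
  have "(\<exists>p. pre_digraph.awalk (with_proj X) u p v \<and> length p = Suc n) \<longleftrightarrow>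
      (\<exists>w. (u, w) \<in> parcs X \<and> (\<exists>p. pre_digraph.awalk (with_proj X) w p v \<and> length p = n))"
    (is "?L \<longleftrightarrow> ?R")
  proof
    assume ?L
    then show ?R
      using assms(2)
      by (fastforce simp: length_Suc_conv pre_digraph.awalk_def pre_digraph.cas.simps)
  next
    assume ?R
    then obtain w p where "(u, w) \<in> parcs X"
      "pre_digraph.awalk (with_proj X) w p v" "length p = n" by blast
    then show ?L
      using Suc.prems
      by (intro exI[of _ "(u, w) # p"])
        (auto simp: pre_digraph.awalk_def pre_digraph.cas.simps)
  qed
  also have "\<dots> \<longleftrightarrow> (\<exists>w. (u, w) \<in> parcs X \<and> (w, v) \<in> parcs X ^^ n)"
    using Suc.IH assms(2) by blast
  also have "\<dots> \<longleftrightarrow> (u, v) \<in> parcs X ^^ Suc n"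
    by (metis relpow_Suc_D2 relpow_Suc_I2)
  finally show ?case .
qed

lemma graph_dist_relpow:
  assumes "u \<in> pverts X" and "parcs X \<subseteq> pverts X \<times> pverts X"
  shows "graph_dist X u v = (LEAST n. (u, v) \<in> parcs X ^^ n)"
  unfolding graph_dist_def awalk_iff_relpow[OF assms] ..

lemma strong_product_arcs_subset:
  "parcs (H \<boxtimes> G) \<subseteq> pverts (H \<boxtimes> G) \<times> pverts (H \<boxtimes> G)"
  by (auto simp: strong_product_def)

lemma relpow_strong_product_column_le:
  assumes "((a, b), (i, v)) \<in> parcs (path_graph t \<boxtimes> G) ^^ n"
  shows "\<bar>int a - int i\<bar> \<le> int n"
  using assms
proof (induction n arbitrary: i v)
  case (Suc n)
  then obtain j w where "((a, b), (j, w)) \<in> parcs (path_graph t \<boxtimes> G) ^^ n"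
    and "((j, w), (i, v)) \<in> parcs (path_graph t \<boxtimes> G)"
    by (metis relpow_Suc_E surj_pair)
  moreover from this(2) have "\<bar>int j - int i\<bar> \<le> 1"
    by (auto simp: strong_product_def path_graph_def)
  ultimately show ?case
    using Suc.IH by fastforce
qed simp

text \<open>Each step moves one column towards \<open>i\<close>. The second coordinate meanwhile
  follows a walk of length \<open>d\<close> and, once it has arrived, waits at
  \<open>v\<close>.\<close>

lemma relpow_strong_product_diagonal:
  assumes "(b, v) \<in> parcs G ^^ d" and "d \<le> m" and "\<bar>int a - int i\<bar> = int m"
    and "a \<in> {1..t}" and "i \<in> {1..t}" and "b \<in> pverts G"
    and arcs: "parcs G \<subseteq> pverts G \<times> pverts G"
  shows "((a, b), (i, v)) \<in> parcs (path_graph t \<boxtimes> G) ^^ m"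
  using assms(1-6)
proof (induction m arbitrary: a b d)
  case (Suc m)
  \<comment> \<open>Since \<open>a\<close> and \<open>i\<close> differ by \<open>Suc m\<close>, the
    else branch has \<open>a > i\<close>, so the subtraction does not truncate.\<close>
  define a' where "a' = (if a < i then a + 1 else a - 1)"
  have a': "\<bar>int a' - int i\<bar> = int m" "a' \<in> {1..t}" "(a, a') \<in> parcs (path_graph t)"
    using Suc.prems(3-5) by (auto simp: a'_def path_graph_def)
  obtain b' d' where b': "(b', v) \<in> parcs G ^^ d'" "d' \<le> m" "b' \<in> pverts G"
    "b' = b \<or> (b, b') \<in> parcs G"
  proof (cases d)
    case 0
    then show ?thesis using that[of b 0] Suc.prems by auto
  next
    case (Suc e)
    then obtain b' where "(b, b') \<in> parcs G" "(b', v) \<in> parcs G ^^ e"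
      using Suc.prems(1) by (metis relpow_Suc_D2)
    then show ?thesis
      using that[of b' e] Suc.prems(2) Suc arcs by auto
  qed
  have "((a, b), (a', b')) \<in> parcs (path_graph t \<boxtimes> G)"
    using a' b' Suc.prems by (auto simp: strong_product_def path_graph_def)
  moreover have "((a', b'), (i, v)) \<in> parcs (path_graph t \<boxtimes> G) ^^ m"
    using Suc.IH[OF b'(1,2) a'(1,2)] Suc.prems(5) b'(3) by blast
  ultimately show ?case
    by (rule relpow_Suc_I2)
qed auto

text \<open>The column difference is always a lower bound, and a diagonal walk attains it. Hence a
  landmark cannot tell apart two vertices of a column that are both this close in
  \<open>G\<close>.\<close>

lemma graph_dist_strong_product_column:
  assumes "(b, v) \<in> parcs G ^^ d" and "int d \<le> \<bar>int a - int i\<bar>"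
    and "a \<in> {1..t}" and "i \<in> {1..t}" and "b \<in> pverts G"
    and "parcs G \<subseteq> pverts G \<times> pverts G"
  shows "int (graph_dist (path_graph t \<boxtimes> G) (a, b) (i, v)) = \<bar>int a - int i\<bar>"
proof -
  define m where "m = nat \<bar>int a - int i\<bar>"
  have m: "\<bar>int a - int i\<bar> = int m" by (simp add: m_def)
  have "(a, b) \<in> pverts (path_graph t \<boxtimes> G)"
    using assms by (auto simp: strong_product_def path_graph_def)
  then have "graph_dist (path_graph t \<boxtimes> G) (a, b) (i, v) =
      (LEAST n. ((a, b), (i, v)) \<in> parcs (path_graph t \<boxtimes> G) ^^ n)"
    by (rule graph_dist_relpow[OF _ strong_product_arcs_subset])
  also have "\<dots> = m"
  proof (rule Least_equality)
    show "((a, b), (i, v)) \<in> parcs (path_graph t \<boxtimes> G) ^^ m"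
      using relpow_strong_product_diagonal[OF assms(1) _ m] assms(2-6) m by simp
  next
    fix n assume "((a, b), (i, v)) \<in> parcs (path_graph t \<boxtimes> G) ^^ n"
    then show "m \<le> n"
      using relpow_strong_product_column_le m by fastforce
  qed
  finally show ?thesis using m by simp
qed

section \<open>Landmarks forced by the edges of a single column\<close>

lemma relpow_symD:
  assumes "sym r" and "(x, y) \<in> r ^^ n"
  shows "(y, x) \<in> r ^^ n"
  using assms(2)
proof (induction n arbitrary: y)
  case (Suc n)
  then obtain z where "(x, z) \<in> r ^^ n" "(z, y) \<in> r" by auto
  then show ?case
    using Suc.IH assms(1) by (metis relpow_Suc_I2 symD)
qed simp

text \<open>
  Two landmarks at column offsets \<open>p\<close> and \<open>q\<close> with \<open>p + q\<close> larger than the distance of their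
  \<open>G\<close>-coordinates leave an edge of a geodesic between these coordinates undistinguished.
\<close>

lemma relpow_undistinguished_edge:
  assumes "sym r" and "(b, b') \<in> r ^^ l" and "l \<ge> 1" and "p \<ge> 1" and "q \<ge> 1" and "l < p + q"
  obtains x y d1 d2 d3 d4 where "(x, y) \<in> r"
    and "(b, x) \<in> r ^^ d1" "d1 \<le> p" and "(b, y) \<in> r ^^ d2" "d2 \<le> p"
    and "(b', x) \<in> r ^^ d3" "d3 \<le> q" and "(b', y) \<in> r ^^ d4" "d4 \<le> q"
proof -
  \<comment> \<open>The edge joins positions \<open>e\<close> and \<open>Suc e\<close> of the walk.
    Its far end is the last position at most \<open>p\<close> steps from \<open>b\<close>, and
    \<open>l < p + q\<close> leaves at most \<open>q\<close> steps from its near end to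
    \<open>b'\<close>.\<close>
  define e where "e = min p l - 1"
  have e: "Suc e \<le> p" "Suc e \<le> l" "l - e \<le> q"
    using assms by (auto simp: e_def min_def)
  have "l = e + Suc (l - Suc e)"
    using e by simp
  then have "(b, b') \<in> r ^^ e O r ^^ Suc (l - Suc e)"
    using assms(2) by (metis relpow_add)
  then obtain x y where xy: "(b, x) \<in> r ^^ e" "(x, y) \<in> r" "(y, b') \<in> r ^^ (l - Suc e)"
    by (metis relcompE relpow_Suc_D2 Pair_inject)
  have yb': "(b', y) \<in> r ^^ (l - Suc e)"
    using relpow_symD[OF assms(1) xy(3)] .
  show thesis
  proof (rule that[of x y e "Suc e" "Suc (l - Suc e)" "l - Suc e"])
    show "(b', x) \<in> r ^^ Suc (l - Suc e)"
      using yb' xy(2) assms(1) by (auto dest: symD)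
  qed (use xy yb' e in auto)
qed

lemma card_ge_3I:
  assumes "finite A" and "x \<in> A" and "y \<in> A" and "z \<in> A" and "x \<noteq> y" and "x \<noteq> z" and "y \<noteq> z"
  shows "3 \<le> card A"
  using card_mono[OF assms(1), of "{x, y, z}"] assms by auto

text \<open>Three edges of the column are tested in turn: an arbitrary one gives \<open>s1\<close>,
  one at \<open>snd s1\<close> gives \<open>s2\<close>, and, if the offsets of \<open>s1\<close> and
  \<open>s2\<close> add up to more than \<open>D\<close>, one on a walk between
  \<open>snd s1\<close> and \<open>snd s2\<close> that is blind to both gives
  \<open>s3\<close>.\<close>

lemma column_landmarks:
  fixes G :: "'a pair_pre_digraph"
  assumes gen: "local_metric_generator (path_graph t \<boxtimes> G) S" and fin: "finite S"
    and symm: "sym (parcs G)" and arcs: "parcs G \<subseteq> pverts G \<times> pverts G"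
    and D: "\<And>u v. u \<in> pverts G \<Longrightarrow> v \<in> pverts G \<Longrightarrow> \<exists>n\<le>D. (u, v) \<in> parcs G ^^ n"
    and nbr: "\<And>u. u \<in> pverts G \<Longrightarrow> \<exists>v. (u, v) \<in> parcs G" and ne: "pverts G \<noteq> {}"
    and i: "i \<in> {1..t}"
  defines "r \<equiv> \<lambda>s. \<bar>int (fst s) - int i\<bar>"
  shows "(\<exists>s\<in>S. fst s = i) \<or> (\<exists>s\<in>S. \<exists>s'\<in>S. s \<noteq> s' \<and> r s + r s' \<le> int D) \<or>
    3 \<le> card {s \<in> S. r s < int D}"
proof (cases "\<exists>s\<in>S. fst s = i")
  case False
  have S: "fst s \<in> {1..t}" "snd s \<in> pverts G" if "s \<in> S" for s
    using gen that by (auto simp: local_metric_generator_def strong_product_def path_graph_def)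
  have r_pos: "r s \<ge> 1" if "s \<in> S" for s
    using False that by (auto simp: r_def)
  have blind: "int (graph_dist (path_graph t \<boxtimes> G) s (i, v)) = r s"
    if "s \<in> S" "(snd s, v) \<in> parcs G ^^ d" "int d \<le> r s" for s v d
    using graph_dist_strong_product_column[OF that(2), where a = "fst s" and i = i and t = t] that(1,3) S i arcs
    by (auto simp: r_def)
  \<comment> \<open>A landmark that distinguishes the edge cannot reach both endpoints in
    \<open>G\<close> by walks of length at most \<open>r s\<close>. Both are reachable within
    \<open>D\<close>, hence \<open>r s < D\<close>.\<close>
  have cover: "\<exists>s\<in>S. r s < int D \<and>
      (\<forall>d d'. (snd s, v) \<in> parcs G ^^ d \<longrightarrow> (snd s, w) \<in> parcs G ^^ d' \<longrightarrow>
        r s < int d \<or> r s < int d')" if vw: "(v, w) \<in> parcs G" for v w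
  proof -
    have "((i, v), (i, w)) \<in> parcs (path_graph t \<boxtimes> G)"
      using vw arcs i by (auto simp: strong_product_def path_graph_def)
    then obtain s where s: "s \<in> S"
      "graph_dist (path_graph t \<boxtimes> G) s (i, v) \<noteq> graph_dist (path_graph t \<boxtimes> G) s (i, w)"
      using gen unfolding local_metric_generator_def by blast
    have far: "r s < int d \<or> r s < int d'"
      if "(snd s, v) \<in> parcs G ^^ d" "(snd s, w) \<in> parcs G ^^ d'" for d d'
      using blind[OF s(1) that(1)] blind[OF s(1) that(2)] s(2) by linarith
    obtain d d' where "d \<le> D" "(snd s, v) \<in> parcs G ^^ d" "d' \<le> D" "(snd s, w) \<in> parcs G ^^ d'"
      using D[of "snd s" v] D[of "snd s" w] S(2)[OF s(1)] vw arcs by blast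
    with far have "r s < int D" by fastforce
    with far s(1) show ?thesis by blast
  qed
  obtain v w where "(v, w) \<in> parcs G" using ne nbr by blast
  then obtain s1 where s1: "s1 \<in> S" "r s1 < int D" using cover by blast
  obtain n where n: "(snd s1, n) \<in> parcs G" using nbr S(2) s1 by blast
  then obtain s2 where s2: "s2 \<in> S" "r s2 < int D"
    and s2_far: "\<And>d d'. (snd s2, snd s1) \<in> parcs G ^^ d \<Longrightarrow> (snd s2, n) \<in> parcs G ^^ d' \<Longrightarrow>
        r s2 < int d \<or> r s2 < int d'"
    using cover by blast
  \<comment> \<open>Otherwise walks of lengths 0 and 1 reach both ends of the edge, and
    \<open>r s2\<close> is at least 1 because the column holds no landmark.\<close>
  have b: "snd s2 \<noteq> snd s1"
  proof
    assume "snd s2 = snd s1"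
    then show False
      using s2_far[of 0 1] n r_pos[OF s2(1)] by simp
  qed
  obtain l where l: "l \<le> D" "(snd s1, snd s2) \<in> parcs G ^^ l"
    using D S(2) s1(1) s2(1) by blast
  have l1: "l \<ge> 1" using l(2) b by (cases l) auto
  show ?thesis
  proof (cases "r s1 + r s2 \<le> int D")
    case True
    moreover have "s1 \<noteq> s2" using b by blast
    ultimately have "\<exists>s\<in>S. \<exists>s'\<in>S. s \<noteq> s' \<and> r s + r s' \<le> int D"
      using s1(1) s2(1) by blast
    then show ?thesis by (intro disjI2 disjI1)
  next
    case far: False
    define p where "p = nat (r s1)"
    define q where "q = nat (r s2)"
    have pq: "r s1 = int p" "r s2 = int q" "p \<ge> 1" "q \<ge> 1" "l < p + q"
      using far l(1) r_pos[OF s1(1)] r_pos[OF s2(1)] by (auto simp: p_def q_def)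
    obtain x y d1 d2 d3 d4 where xy: "(x, y) \<in> parcs G"
      "(snd s1, x) \<in> parcs G ^^ d1" "d1 \<le> p" "(snd s1, y) \<in> parcs G ^^ d2" "d2 \<le> p"
      "(snd s2, x) \<in> parcs G ^^ d3" "d3 \<le> q" "(snd s2, y) \<in> parcs G ^^ d4" "d4 \<le> q"
      using relpow_undistinguished_edge[OF symm l(2) l1 pq(3,4,5)] by metis
    obtain s3 where s3: "s3 \<in> S" "r s3 < int D"
      and s3_far: "\<And>d d'. (snd s3, x) \<in> parcs G ^^ d \<Longrightarrow> (snd s3, y) \<in> parcs G ^^ d' \<Longrightarrow>
        r s3 < int d \<or> r s3 < int d'"
      using cover[OF xy(1)] by blast
    have "s3 \<noteq> s1" using s3_far[of d1 d2] xy pq by auto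
    moreover have "s3 \<noteq> s2" using s3_far[of d3 d4] xy pq by auto
    moreover have "s1 \<noteq> s2" using b by blast
    ultimately have "3 \<le> card {s \<in> S. r s < int D}"
      using s1 s2 s3 fin by (intro card_ge_3I[of _ s1 s2 s3]) auto
    then show ?thesis by (intro disjI2)
  qed
qed blast


section \<open>Gaps between consecutive landmark columns\<close>

text \<open>The alternatives of \<open>column_landmarks\<close> for a list \<open>f\<close> of
  \<open>k\<close> columns. Distinct landmarks become distinct indices, because their columns may
  coincide.\<close>

definition column_covered :: "int \<Rightarrow> (nat \<Rightarrow> int) \<Rightarrow> nat \<Rightarrow> int \<Rightarrow> bool" where
  "column_covered D f k i \<longleftrightarrow> (\<exists>j<k. f j = i) \<or>
     (\<exists>j l. j < l \<and> l < k \<and> \<bar>f j - i\<bar> + \<bar>f l - i\<bar> \<le> D) \<or>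
     (\<exists>j l m. j < l \<and> l < m \<and> m < k \<and> \<bar>f j - i\<bar> < D \<and> \<bar>f l - i\<bar> < D \<and> \<bar>f m - i\<bar> < D)"

text \<open>Reflection keeps all offsets. Reversing the indices as well keeps a sorted list sorted,
  so that estimates from the left can be used from the right.\<close>

lemma column_covered_reflect:
  assumes "column_covered D f k (c - i)"
  shows "column_covered D (\<lambda>j. c - f (k - 1 - j)) k i"
proof -
  let ?h = "\<lambda>j. c - f (k - 1 - j)"
  have flip: "?h (k - 1 - j) = c - f j" if "j < k" for j
    using that by simp
  from assms consider j where "j < k" "f j = c - i"
    | j l where "j < l" "l < k" "\<bar>f j - (c - i)\<bar> + \<bar>f l - (c - i)\<bar> \<le> D"
    | j l m where "j < l" "l < m" "m < k"
      "\<bar>f j - (c - i)\<bar> < D" "\<bar>f l - (c - i)\<bar> < D" "\<bar>f m - (c - i)\<bar> < D"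
    unfolding column_covered_def by blast
  then show ?thesis
  proof cases
    case 1
    then have "k - 1 - j < k \<and> ?h (k - 1 - j) = i"
      using flip[of j] by simp
    then show ?thesis unfolding column_covered_def by blast
  next
    case 2
    then have "k - 1 - l < k - 1 - j \<and> k - 1 - j < k \<and>
        \<bar>?h (k - 1 - l) - i\<bar> + \<bar>?h (k - 1 - j) - i\<bar> \<le> D"
      using flip[of j] flip[of l] by auto
    then show ?thesis unfolding column_covered_def by blast
  next
    case 3
    then have "k - 1 - m < k - 1 - l \<and> k - 1 - l < k - 1 - j \<and> k - 1 - j < k \<and>
        \<bar>?h (k - 1 - m) - i\<bar> < D \<and> \<bar>?h (k - 1 - l) - i\<bar> < D \<and> \<bar>?h (k - 1 - j) - i\<bar> < D"
      using flip[of j] flip[of l] flip[of m] by auto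
    then show ?thesis unfolding column_covered_def by blast
  qed
qed

text \<open>Landmarks on opposite sides of a long gap have offsets adding up to more than
  \<open>D\<close>, and of three landmarks two lie on the same side. So every column in the gap is
  less than \<open>D\<close> away from the second nearest landmark on one side; three test columns
  give the claim.\<close>

lemma column_covered_gap:
  fixes f :: "nat \<Rightarrow> int"
  assumes mono: "\<And>j l. j \<le> l \<Longrightarrow> l < k \<Longrightarrow> f j \<le> f l"
    and cov: "\<And>i. f j < i \<Longrightarrow> i < f (j + 1) \<Longrightarrow> column_covered D f k i"
    and D: "D \<ge> 1" and j: "j + 1 < k" and gap: "f (j + 1) - f j > D"
  shows "1 \<le> j \<and> j + 2 < k \<and> f (j + 2) - f (j - 1) < 2 * D"
proof -
  have side: "(1 \<le> j \<and> i - f (j - 1) < D) \<or> (j + 2 < k \<and> f (j + 2) - i < D)"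
    if i: "f j < i" "i < f (j + 1)" for i
  proof -
    have L: "f a \<le> f j" if "a \<le> j" for a using mono[of a j] that j by simp
    have L1: "1 \<le> j \<and> f a \<le> f (j - 1)" if "a < c" "c \<le> j" for a c
      using mono[of a "j - 1"] that j by simp
    have R: "f a \<ge> f (j + 1)" if "a > j" "a < k" for a using mono[of "j + 1" a] that by simp
    have R1: "j + 2 < k \<and> f c \<ge> f (j + 2)" if "a > j" "a < c" "c < k" for a c
      using mono[of "j + 2" c] that by simp
    from cov[OF i] show ?thesis unfolding column_covered_def
    proof (elim disjE exE conjE)
      fix a assume "a < k" "f a = i"
      then show ?thesis using L[of a] R[of a] i by (cases "a \<le> j") auto
    next
      fix a c assume ac: "a < c" "c < k" "\<bar>f a - i\<bar> + \<bar>f c - i\<bar> \<le> D"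
      consider "c \<le> j" | "a \<le> j" "j < c" | "j < a" by linarith
      then show ?thesis
      proof cases
        case 1 then show ?thesis using L1[of a c] L[of c] ac i by linarith
      next
        case 2 then show ?thesis using L[of a] R[of c] ac i gap by linarith
      next
        case 3 then show ?thesis using R1[of a c] R[of a] ac i by linarith
      qed
    next
      fix a c e assume ace: "a < c" "c < e" "e < k" "\<bar>f a - i\<bar> < D" "\<bar>f c - i\<bar> < D" "\<bar>f e - i\<bar> < D"
      show ?thesis
      proof (cases "c \<le> j")
        case True then show ?thesis using L1[of a c] ace by linarith
      next
        case False then show ?thesis using R1[of c e] ace by linarith
      qed
    qed
  qed
  have right: "f (j + 1) \<le> f (j + 2)" if "j + 2 < k" using mono[of "j + 1" "j + 2"] that by simp
  have left: "f (j - 1) \<le> f j" using mono[of "j - 1" j] j by simp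
  \<comment> \<open>Next to either end of the gap, the landmarks across it are too far away, so the
    near side must serve.\<close>
  have l: "1 \<le> j" "f j + 1 - f (j - 1) < D"
    using side[of "f j + 1"] right gap D by auto
  have r: "j + 2 < k"
    using side[of "f (j + 1) - 1"] left gap D by auto
  \<comment> \<open>The column \<open>f (j - 1) + D\<close> lies inside the gap and is the first one
    that the left side no longer serves.\<close>
  have "f (j + 2) - (f (j - 1) + D) < D"
    using side[of "f (j - 1) + D"] l left gap by auto
  with l r show ?thesis by simp
qed

text \<open>
  The left margin is counted twice and the right one not at all: in this form each long gap can be
  paired with the short gap to its right.  The mean with the mirrored estimate counts each margin
  once.
\<close>

lemma column_covered_left_bound:
  fixes f :: "nat \<Rightarrow> int"
  assumes mono: "\<And>j l. j \<le> l \<Longrightarrow> l < k \<Longrightarrow> f j \<le> f l"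
    and range: "\<And>j. j < k \<Longrightarrow> 1 \<le> f j \<and> f j \<le> T"
    and cov: "\<And>i. 1 \<le> i \<Longrightarrow> i \<le> T \<Longrightarrow> column_covered D f k i"
    and D: "D \<ge> 1" and k: "k \<ge> 2"
  shows "2 * (f 0 - 1) + f (k - 1) - f 0 \<le> D * int (k - 1)"
proof -
  have gap: "1 \<le> j \<and> j + 2 < k \<and> f (j + 2) - f (j - 1) < 2 * D"
    if "j + 1 < k" "f (j + 1) - f j > D" for j
  proof (rule column_covered_gap[OF mono _ D that])
    fix i assume "f j < i" "i < f (j + 1)"
    then show "column_covered D f k i"
      using range[of j] range[of "j + 1"] that(1) by (intro cov) auto
  qed
  have first: "f 1 - f 0 \<le> D" using gap[of 0] k by fastforce
  \<comment> \<open>The left side equals \<open>(f 0 - 1) + (f 1 - 1)\<close>: the first two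
    landmarks cover column 1 as a pair. This is also the case \<open>j = 1\<close> of
    \<open>main\<close>; if it fails, the induction starts at \<open>j = 2\<close>.\<close>
  define early where "early \<longleftrightarrow> 2 * (f 0 - 1) + f 1 - f 0 \<le> D"
  have late: "3 \<le> k \<and> f 2 - 1 < D" if "\<not> early"
  proof -
    have "column_covered D f k 1" using range[of 0] k by (intro cov) auto
    then show ?thesis unfolding column_covered_def
    proof (elim disjE exE conjE)
      fix j assume "j < k" "f j = 1"
      then have "f 0 = 1" using mono[of 0 j] range[of 0] k by auto
      then show ?thesis using that first by (simp add: early_def)
    next
      fix j l assume "j < l" "l < k" "\<bar>f j - 1\<bar> + \<bar>f l - 1\<bar> \<le> D"
      then show ?thesis
        using that mono[of 0 j] mono[of 1 l] range[of 0] by (auto simp: early_def)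
    next
      fix j l m assume "j < l" "l < m" "m < k" "\<bar>f j - 1\<bar> < D" "\<bar>f l - 1\<bar> < D" "\<bar>f m - 1\<bar> < D"
      then show ?thesis
        using mono[of 2 m] by auto
    qed
  qed
  \<comment> \<open>Only indices after a short gap are considered, since the bound may fail right
    after a long one. The induction goes back one index, or two if the preceding gap is
    long.\<close>
  have main: "2 * (f 0 - 1) + f j - f 0 \<le> D * int j"
    if "1 \<le> j" "j < k" "f j - f (j - 1) \<le> D" "early \<or> 2 \<le> j" for j
    using that
  proof (induction j rule: less_induct)
    case (less j)
    consider "j = 1" | "j = 2" "\<not> early" | "2 \<le> j" "early \<or> 3 \<le> j"
      using less.prems by linarith
    then show ?case
    proof cases
      case 1
      then show ?thesis using less.prems by (simp add: early_def)
    next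
      case 2
      then show ?thesis using late range[of 0] mono[of 0 2] less.prems by auto
    next
      case 3
      show ?thesis
      proof (cases "f (j - 1) - f (j - 2) \<le> D")
        case True
        have j1: "j - 1 - 1 = j - 2" by simp
        have "1 \<le> j - 1" "j - 1 < j" "j - 1 < k" "early \<or> 2 \<le> j - 1"
          using 3 less.prems by auto
        with True have "2 * (f 0 - 1) + f (j - 1) - f 0 \<le> D * int (j - 1)"
          using less.IH[of "j - 1"] unfolding j1 by blast
        moreover have "D * int j = D * int (j - 1) + D"
          using 3 by (simp add: of_nat_diff algebra_simps)
        ultimately show ?thesis using less.prems(3) by linarith
      next
        case False
        have j2: "j - 2 + 1 = j - 1" "j - 2 + 2 = j" "j - 2 - 1 = j - 3" using 3 by auto
        \<comment> \<open>The gap from \<open>j - 2\<close> to \<open>j - 1\<close> is long.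
          Together with the next one it contributes less than \<open>2 * D\<close>, and the gap
          before it is short, so the hypothesis applies at \<open>j - 2\<close>.\<close>
        have big: "1 \<le> j - 2" "f j - f (j - 3) < 2 * D"
          using gap[of "j - 2"] False less.prems 3 unfolding j2 by auto
        have le: "f (j - 3) \<le> f (j - 2)" "f (j - 2) \<le> f (j - 1)" "f (j - 1) \<le> f j"
          using mono[of "j - 3" "j - 2"] mono[of "j - 2" "j - 1"] mono[of "j - 1" j] less.prems by auto
        \<comment> \<open>For \<open>j = 3\<close> without \<open>early\<close>, the long gap
          \<open>f 2 - f 1 > D\<close> would contradict \<open>f 2 - 1 < D\<close>.\<close>
        have "early \<or> 2 \<le> j - 2"
        proof (rule ccontr)
          assume "\<not> (early \<or> 2 \<le> j - 2)"
          then have "\<not> early" "j = 3" using 3 by auto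
          then show False
            using late False range[of 1] by auto
        qed
        moreover have "f (j - 2) - f (j - 2 - 1) \<le> D"
          using big le False unfolding j2 by linarith
        ultimately have "2 * (f 0 - 1) + f (j - 2) - f 0 \<le> D * int (j - 2)"
          using less.IH[of "j - 2"] less.prems big(1) by auto
        moreover have "D * int j = D * int (j - 2) + 2 * D"
          using 3 by (simp add: of_nat_diff algebra_simps)
        ultimately show ?thesis using big le by linarith
      qed
    qed
  qed
  \<comment> \<open>A long gap has a further gap to its right, so the last gap is short and
    \<open>main\<close> reaches \<open>k - 1\<close>.\<close>
  have "f (k - 1) - f (k - 2) \<le> D"
  proof (rule ccontr)
    have k2: "k - 2 + 1 = k - 1" "k - 2 + 2 = k" using k by auto
    assume "\<not> ?thesis"
    then show False using gap[of "k - 2"] k unfolding k2 by auto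
  qed
  moreover have "k - 1 - 1 = k - 2" by simp
  ultimately show ?thesis using main[of "k - 1"] late k by fastforce
qed

text \<open>The left sides of the estimates for \<open>f\<close> and for its mirror image add up to
  \<open>2 * (T - 1)\<close>.\<close>

lemma column_covered_bound:
  fixes f :: "nat \<Rightarrow> int"
  assumes mono: "\<And>j l. j \<le> l \<Longrightarrow> l < k \<Longrightarrow> f j \<le> f l"
    and range: "\<And>j. j < k \<Longrightarrow> 1 \<le> f j \<and> f j \<le> T"
    and cov: "\<And>i. 1 \<le> i \<Longrightarrow> i \<le> T \<Longrightarrow> column_covered D f k i"
    and D: "D \<ge> 1" and T: "T \<ge> 2"
  shows "T - 1 \<le> D * (int k - 1)"
proof -
  \<comment> \<open>A single landmark covers only its own column, but columns 1 and \<open>T\<close>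
    are distinct.\<close>
  have k: "k \<ge> 2"
  proof (rule ccontr)
    assume "\<not> k \<ge> 2"
    then have "j = 0" if "j < k" for j using that by simp
    then have "f 0 = i" if "1 \<le> i" "i \<le> T" for i
      using cov[OF that] \<open>\<not> k \<ge> 2\<close> unfolding column_covered_def by fastforce
    from this[of 1] this[of T] T show False by simp
  qed
  have "2 * (f 0 - 1) + f (k - 1) - f 0 \<le> D * int (k - 1)"
    by (rule column_covered_left_bound[OF mono range cov D k])
  moreover
  let ?g = "\<lambda>j. T + 1 - f (k - 1 - j)"
  have "2 * (?g 0 - 1) + ?g (k - 1) - ?g 0 \<le> D * int (k - 1)"
  proof (rule column_covered_left_bound[OF _ _ _ D k])
    show "?g j \<le> ?g l" if "j \<le> l" "l < k" for j l
      using mono[of "k - 1 - l" "k - 1 - j"] that by auto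
    show "1 \<le> ?g j \<and> ?g j \<le> T" if "j < k" for j
      using range[of "k - 1 - j"] that by auto
    show "column_covered D ?g k i" if "1 \<le> i" "i \<le> T" for i
      using that by (intro column_covered_reflect cov) auto
  qed
  ultimately show ?thesis using k by (simp add: of_nat_diff)
qed

section \<open>From sets of landmarks to sorted lists\<close>

lemma three_distinct_ordered:
  fixes a b c :: "'a::linorder"
  assumes "a \<noteq> b" "a \<noteq> c" "b \<noteq> c" "P a" "P b" "P c"
  shows "\<exists>j l m. j < l \<and> l < m \<and> P j \<and> P l \<and> P m"
proof -
  consider "a < b" "b < c" | "a < c" "c < b" | "b < a" "a < c"
    | "b < c" "c < a" | "c < a" "a < b" | "c < b" "b < a"
    using assms(1-3) by (meson linorder_neqE)
  then show ?thesis
    by cases (use assms(4-6) in blast)+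
qed

text \<open>A repetition-free enumeration of \<open>S\<close>, sorted by \<open>c\<close>, turns
  distinct landmarks into distinct indices and makes the columns nondecreasing.\<close>

lemma landmark_count_bound:
  fixes c :: "'b \<Rightarrow> nat"
  assumes fin: "finite S" and range: "\<And>s. s \<in> S \<Longrightarrow> c s \<in> {1..t}" and D: "D \<ge> 1" and t: "t \<ge> 2"
    and cov: "\<And>i. i \<in> {1..t} \<Longrightarrow> (\<exists>s\<in>S. c s = i) \<or>
      (\<exists>s\<in>S. \<exists>s'\<in>S. s \<noteq> s' \<and> \<bar>int (c s) - int i\<bar> + \<bar>int (c s') - int i\<bar> \<le> int D) \<or>
      3 \<le> card {s \<in> S. \<bar>int (c s) - int i\<bar> < int D}"
  shows "int t - 1 \<le> int D * (int (card S) - 1)"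
proof -
  obtain ys where ys: "set ys = S" "distinct ys"
    using finite_distinct_list[OF fin] by blast
  define xs where "xs = sort_key c ys"
  have xs: "set xs = S" "distinct xs" "sorted (map c xs)" "length xs = card S"
    using ys distinct_card[of ys] by (auto simp: xs_def)
  define f where "f j = int (c (xs ! j))" for j
  have idx: "\<exists>j<card S. xs ! j = s" if "s \<in> S" for s
    using that xs by (metis in_set_conv_nth)
  show ?thesis
  proof (rule column_covered_bound[of "card S" f "int t" "int D"])
    show "f j \<le> f l" if "j \<le> l" "l < card S" for j l
      using sorted_nth_mono[OF xs(3) that(1)] that xs(4) by (simp add: f_def)
    show "1 \<le> f j \<and> f j \<le> int t" if "j < card S" for j
      using range[of "xs ! j"] xs that nth_mem[of j xs] by (auto simp: f_def)
    show "column_covered (int D) f (card S) i" if "1 \<le> i" "i \<le> int t" for i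
    proof -
      define n where "n = nat i"
      have n: "i = int n" "n \<in> {1..t}" using that by (auto simp: n_def)
      from cov[OF n(2)] consider s where "s \<in> S" "c s = n"
        | s s' where "s \<in> S" "s' \<in> S" "s \<noteq> s'" "\<bar>int (c s) - i\<bar> + \<bar>int (c s') - i\<bar> \<le> int D"
        | "3 \<le> card {s \<in> S. \<bar>int (c s) - i\<bar> < int D}"
        unfolding n(1) by blast
      then show ?thesis
      proof cases
        case 1
        then show ?thesis
          using idx[of s] n by (auto simp: column_covered_def f_def)
      next
        case 2
        obtain j l where jl: "j < card S" "xs ! j = s" "l < card S" "xs ! l = s'"
          using idx[OF 2(1)] idx[OF 2(2)] by blast
        then have "\<bar>f j - i\<bar> + \<bar>f l - i\<bar> \<le> int D" "\<bar>f l - i\<bar> + \<bar>f j - i\<bar> \<le> int D" "j \<noteq> l"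
          using 2 by (auto simp: f_def)
        with jl have "\<exists>j l. j < l \<and> l < card S \<and> \<bar>f j - i\<bar> + \<bar>f l - i\<bar> \<le> int D"
          by (cases "j < l") (blast, metis linorder_neqE_nat)
        then show ?thesis
          unfolding column_covered_def by (intro disjI2 disjI1)
      next
        case 3
        then obtain B where B: "B \<subseteq> {s \<in> S. \<bar>int (c s) - i\<bar> < int D}" "card B = 3"
          by (rule obtain_subset_with_card_n)
        then obtain x y z where xyz: "x \<in> S" "y \<in> S" "z \<in> S" "x \<noteq> y" "x \<noteq> z" "y \<noteq> z"
          "\<bar>int (c x) - i\<bar> < int D" "\<bar>int (c y) - i\<bar> < int D" "\<bar>int (c z) - i\<bar> < int D"
          unfolding card_3_iff by auto
        obtain j l m where "j < card S" "xs ! j = x" "l < card S" "xs ! l = y" "m < card S" "xs ! m = z"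
          using idx[OF xyz(1)] idx[OF xyz(2)] idx[OF xyz(3)] by blast
        then have "\<exists>j l m. j < l \<and> l < m \<and> (j < card S \<and> \<bar>f j - i\<bar> < int D) \<and>
            (l < card S \<and> \<bar>f l - i\<bar> < int D) \<and> (m < card S \<and> \<bar>f m - i\<bar> < int D)"
          using xyz by (intro three_distinct_ordered[of j l m]) (auto simp: f_def)
        then show ?thesis
          unfolding column_covered_def by (intro disjI2) blast
      qed
    qed
  qed (use D t in auto)
qed

section \<open>Existence of a minimum generator, and the bound on the dimension\<close>

lemma graph_dist_self:
  assumes "x \<in> pverts X" "parcs X \<subseteq> pverts X \<times> pverts X"
  shows "graph_dist X x x = 0"
  unfolding graph_dist_relpow[OF assms] by (rule Least_eq_0) simp

text \<open>An endpoint distinguishes its own edge, being at distance 0 from itself only. This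
  ensures that the \<open>LEAST\<close> in \<open>local_metric_dim\<close> is attained.\<close>

lemma local_metric_generator_pverts:
  assumes arcs: "parcs X \<subseteq> pverts X \<times> pverts X" and "irrefl (parcs X)"
  shows "local_metric_generator X (pverts X)"
  unfolding local_metric_generator_def
proof (intro conjI allI impI subset_refl)
  fix x y assume xy: "(x, y) \<in> parcs X"
  then have x: "x \<in> pverts X" using arcs by blast
  have "(x, y) \<in> parcs X ^^ graph_dist X x y"
    unfolding graph_dist_relpow[OF x arcs] by (rule LeastI[of _ 1]) (use xy in simp)
  moreover have "x \<noteq> y" using xy assms(2) by (auto simp: irrefl_def)
  ultimately have "graph_dist X x y \<noteq> 0" by (auto intro: ccontr)
  then show "\<exists>s\<in>pverts X. graph_dist X s x \<noteq> graph_dist X s y"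
    using graph_dist_self[OF x arcs] x by metis
qed

theorem theorem16:
  fixes G :: "'a pair_pre_digraph" and t :: nat
  assumes "pair_graph G"
    and "Digraph_Component.connected (with_proj G)"
    and "card (pverts G) \<ge> 2"
    and "t \<ge> 2 * diam G + 1"
  shows "int (local_metric_dim (path_graph t \<boxtimes> G))
           \<ge> \<lceil>(real t - 1) / real (diam G)\<rceil> + 1"
proof -
  interpret pair_graph G by fact
  have arcs: "parcs G \<subseteq> pverts G \<times> pverts G"
    using wellformed' by auto
  have symm: "sym (parcs G)"
    using pair_sym_arcs by (simp add: symmetric_def)
  have irr: "irrefl (parcs G)"
    using pair_no_loops by (fastforce simp: irrefl_def)
  \<comment> \<open>Connectedness is strong connectedness of the symmetric closure, which has the
    same arcs as \<open>G\<close>.\<close>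
  have conn: "(u, v) \<in> (parcs G)\<^sup>*" if "u \<in> pverts G" "v \<in> pverts G" for u v
  proof -
    have "u \<rightarrow>\<^sup>*\<^bsub>mk_symmetric (with_proj G)\<^esub> v"
      using assms(2) that
      by (auto simp: Digraph_Component.connected_def strongly_connected_def)
    then have "(u, v) \<in> (arcs_ends (mk_symmetric (with_proj G)))\<^sup>*"
      by (rule reachable_rtranclI)
    also have "arcs_ends (mk_symmetric (with_proj G)) = parcs G"
      by (simp add: adj_mk_symmetric_eq pair_sym_arcs)
    finally show ?thesis .
  qed
  define D where "D = diam G"
  have fin: "finite (pverts G)" by (rule pair_finite_verts)
  have dist_le: "graph_dist G u v \<le> D" if "u \<in> pverts G" "v \<in> pverts G" for u v
  proof -
    have "{graph_dist G u v | u v. u \<in> pverts G \<and> v \<in> pverts G} =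
        (\<lambda>(u, v). graph_dist G u v) ` (pverts G \<times> pverts G)" by auto
    then have "finite {graph_dist G u v | u v. u \<in> pverts G \<and> v \<in> pverts G}"
      using fin by simp
    then show ?thesis unfolding D_def diam_def using that by (intro Max_ge) auto
  qed
  have geodesic: "\<exists>n\<le>D. (u, v) \<in> parcs G ^^ n" if uv: "u \<in> pverts G" "v \<in> pverts G" for u v
  proof -
    have "\<exists>n. (u, v) \<in> parcs G ^^ n"
      using conn[OF uv] by (simp add: rtrancl_power)
    then have "(u, v) \<in> parcs G ^^ graph_dist G u v"
      unfolding graph_dist_relpow[OF uv(1) arcs] by (rule LeastI_ex)
    then show ?thesis using dist_le[OF uv] by blast
  qed
  have other: "\<exists>v\<in>pverts G. v \<noteq> u" for u
  proof (rule ccontr)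
    assume "\<not> ?thesis"
    then have "pverts G \<subseteq> {u}" by auto
    then show False using assms(3) card_mono[of "{u}" "pverts G"] by simp
  qed
  have nbr: "\<exists>v. (u, v) \<in> parcs G" if "u \<in> pverts G" for u
    using other[of u] conn[OF that] by (metis converse_rtranclE)
  have ne: "pverts G \<noteq> {}" using other by blast
  \<comment> \<open>Two distinct vertices are not joined by a walk of length 0. Positivity of
    \<open>D\<close> later permits the division.\<close>
  have D: "D \<ge> 1"
  proof (rule ccontr)
    assume "\<not> D \<ge> 1"
    obtain u v where "u \<in> pverts G" "v \<in> pverts G" "v \<noteq> u" using ne other by blast
    moreover from this obtain n where "n \<le> D" "(u, v) \<in> parcs G ^^ n" using geodesic by blast
    ultimately show False using \<open>\<not> D \<ge> 1\<close> by (cases n) auto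
  qed
  have t: "t \<ge> 2" using assms(4) D by (simp add: D_def)
  let ?X = "path_graph t \<boxtimes> G"
  have irrX: "irrefl (parcs ?X)"
    using irr by (auto simp: irrefl_def strong_product_def path_graph_def)
  have "\<exists>S. local_metric_generator ?X S \<and> card S = card (pverts ?X)"
    using local_metric_generator_pverts[OF strong_product_arcs_subset irrX] by blast
  then have "\<exists>S. local_metric_generator ?X S \<and> card S = local_metric_dim ?X"
    unfolding local_metric_dim_def by (rule LeastI)
  then obtain S where S: "local_metric_generator ?X S" "card S = local_metric_dim ?X" by blast
  have vX: "pverts ?X = {1..t} \<times> pverts G"
    by (simp add: strong_product_def path_graph_def)
  have SX: "S \<subseteq> {1..t} \<times> pverts G"
    using S(1) vX by (simp add: local_metric_generator_def)
  then have finS: "finite S" using fin finite_subset by blast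
  have "int t - 1 \<le> int D * (int (card S) - 1)"
  proof (rule landmark_count_bound[where c = fst, OF finS _ D t])
    show "fst s \<in> {1..t}" if "s \<in> S" for s using SX that by auto
  qed (rule column_landmarks[OF S(1) finS symm arcs geodesic nbr ne])
  then have "real_of_int (int t - 1) \<le> real_of_int (int D * (int (card S) - 1))"
    by (rule of_int_le_iff[THEN iffD2])
  then have "(real t - 1) / real D \<le> real (card S) - 1"
    using D by (simp add: divide_le_eq mult.commute)
  then have "\<lceil>(real t - 1) / real D\<rceil> \<le> int (card S) - 1"
    by (intro ceiling_le) simp
  then show ?thesis using S(2) by (simp add: D_def)
qed

end
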